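(* For any integer $n \ge 0$, we have \[\mathrm{pod}_{-4}(27n+5)\equiv -\mathrm{pod}_{-4}(9n+2) \pmod{9},\] \[\mathrm{pod}_{-4}(27n+14)\equiv -\mathrm{pod}_{-4}(9n+5) \pmod{81},\] \[\mathrm{pod}_{-4}(27n+23)\equiv -\mathrm{pod}_{-4}(9n+8) \pmod{27}.\]
   Context: For a positive integer $k$, $\mathrm{pod}_{-k}(n)$ denotes the number of partition $k$-tuples of $n$ (that is, $k$-tuples of partitions whose sizes sum to $n$) such that in each of the $k$ partitions the odd parts are distinct. Its generating function is \[\sum_{n\ge 0}\mathrm{pod}_{-k}(n)q^n=\prod_{j\ge 1}\frac{(1+q^{2j-1})^k}{(1-q^{2j})^k}=\frac{1}{\psi(-q)^k},\qquad \psi(q)=\sum_{n=0}^{\infty}q^{n(n+1)/2}.\] *)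

theory Defs
  imports "HOL-Library.Multiset" "HOL-Number_Theory.Cong"
begin

text \<open>A partition is the multiset of its parts, so its size is \<open>sum_mset\<close>.\<close>

definition odd_distinct_partition :: "nat multiset \<Rightarrow> bool" where
  "odd_distinct_partition p \<longleftrightarrow>
     (\<forall>i\<in>#p. 0 < i) \<and> (\<forall>i\<in>#p. odd i \<longrightarrow> count p i = 1)"

definition pod_tuples :: "nat \<Rightarrow> nat \<Rightarrow> nat multiset list set" where
  "pod_tuples k n =
     {ps. length ps = k \<and> (\<forall>p\<in>set ps. odd_distinct_partition p) \<and>
          (\<Sum>p\<leftarrow>ps. sum_mset p) = n}"

text \<open>\<open>pod_neg k n\<close> is $\mathrm{pod}_{-k}(n)$.\<close>

definition pod_neg :: "nat \<Rightarrow> nat \<Rightarrow> nat" where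
  "pod_neg k n = card (pod_tuples k n)"

lemma size_le_sum_mset:
  fixes p :: "nat multiset"
  assumes "\<forall>i\<in>#p. 0 < i"
  shows "size p \<le> sum_mset p"
  using assms by (induction p) auto

lemma finite_pod_tuples: "finite (pod_tuples k n)"
proof -
  let ?P = "mset ` {xs. set xs \<subseteq> {..n} \<and> length xs \<le> n}"
  have fin: "finite {ps. set ps \<subseteq> ?P \<and> length ps = k}"
    by (intro finite_lists_length_eq finite_imageI finite_lists_length_le) simp
  have "p \<in> ?P" if ps: "ps \<in> pod_tuples k n" and p: "p \<in> set ps" for ps p
  proof -
    have le: "sum_mset p \<le> n"
      using ps p member_le_sum_list[of "sum_mset p" "map sum_mset ps"]
      by (auto simp: pod_tuples_def)
    have "\<forall>i\<in>#p. 0 < i"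
      using ps p by (auto simp: pod_tuples_def odd_distinct_partition_def)
    then have "size p \<le> n"
      using size_le_sum_mset le by (meson le_trans)
    moreover have "i \<le> n" if "i \<in># p" for i
      using sum_mset.remove[OF that] le by simp
    moreover obtain xs where "p = mset xs"
      by (metis ex_mset)
    ultimately show ?thesis
      by auto
  qed
  then have "pod_tuples k n \<subseteq> {ps. set ps \<subseteq> ?P \<and> length ps = k}"
    by (auto simp: pod_tuples_def simp del: image_iff)
  then show ?thesis
    using fin finite_subset by blast
qed

end

theory Submission
  imports Defs "HOL-Computational_Algebra.Formal_Power_Series"
begin

text \<open>
  Replacing \<open>q\<close> by \<open>-q\<close>, the generating function of the signed numbers
  \<open>a(n) = (-1)\<^sup>n pod\<^bsub>-4\<^esub>(n)\<close> is \<open>F\<^sup>4\<close> with \<open>F = 1/\<psi>(q)\<close>, and the three congruences compare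
  \<open>a(9m+5)\<close> with \<open>a(3m+2)\<close> for \<open>m = 3n, 3n+1, 3n+2\<close>. Write \<open>\<psi>(q) = A(q\<^sup>3) + q \<psi>(q\<^sup>9)\<close> and
  \<open>B = \<psi>(q\<^sup>3)\<close>. The product formula for \<open>\<psi>\<close> gives \<open>(A\<^sup>3 + q B\<^sup>3) B = \<psi>\<^sup>4\<close>, so that
  \<open>F(q) = F(q\<^sup>3)\<^sup>4 B(q\<^sup>3) (A(q\<^sup>3)\<^sup>2 - q A(q\<^sup>3) B(q\<^sup>3) + q\<^sup>2 B(q\<^sup>3)\<^sup>2)\<close>
  and every subsequence of \<open>F\<^sup>k\<close> along a residue class modulo 3 is explicit. In particular
  \<open>\<Sum> a(3m+2) q\<^sup>m = 10 B\<^sup>4 F\<^sup>8 - 36 q B\<^sup>8 F\<^bsup>12\<^esup> + 27 q\<^sup>2 B\<^bsup>12\<^esup> F\<^bsup>16\<^esup>\<close>, and trisecting once more yields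
  \<open>\<Sum> (a(9m+5) - a(3m+2)) q\<^sup>m \<equiv> 9 (4 B\<^sup>4 F\<^sup>8 + 5 q B\<^sup>8 F\<^bsup>12\<^esup>)\<close> modulo 81. A third trisection shows
  that the coefficients of the right-hand side vanish modulo 81 for \<open>m \<equiv> 1\<close> and modulo 27 for \<open>m \<equiv> 2\<close>.
\<close>

unbundle fps_syntax

section \<open>Trisection of power series\<close>

definition cubed :: "int fps \<Rightarrow> int fps" where
  "cubed f = f oo fps_X ^ 3"

definition trisect :: "nat \<Rightarrow> int fps \<Rightarrow> int fps" where
  "trisect r f = Abs_fps (\<lambda>n. f $ (3 * n + r))"

lemma trisect_nth [simp]: "trisect r f $ n = f $ (3 * n + r)"
  by (simp add: trisect_def)

lemma cubed_nth: "cubed f $ n = (if 3 dvd n then f $ (n div 3) else 0)"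
proof -
  have "cubed f $ n = (\<Sum>i=0..n. if n = 3 * i then f $ i else 0)"
    by (simp add: cubed_def fps_compose_nth if_distrib eq_commute cong: if_cong flip: power_mult)
  also have "\<dots> = (\<Sum>i=0..n. if i = n div 3 \<and> 3 dvd n then f $ i else 0)"
    by (intro sum.cong) auto
  also have "\<dots> = (if 3 dvd n then f $ (n div 3) else 0)"
    by auto
  finally show ?thesis .
qed

lemma cubed_add: "cubed (f + g) = cubed f + cubed g"
  and cubed_diff: "cubed (f - g) = cubed f - cubed g"
  and cubed_mult: "cubed (f * g) = cubed f * cubed g"
  and cubed_power: "cubed (f ^ k) = cubed f ^ k"
  and cubed_1 [simp]: "cubed 1 = 1"
  by (simp_all add: cubed_def fps_compose_add_distrib fps_compose_sub_distrib
      fps_compose_mult_distrib fps_compose_power)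

lemma cubed_X_power: "cubed (fps_X ^ k) = fps_X ^ (3 * k)"
  by (auto simp: fps_eq_iff cubed_nth)

lemma cubed_X: "cubed fps_X = fps_X ^ 3"
  using cubed_X_power [of 1] by simp

lemma trisect_add: "trisect r (f + g) = trisect r f + trisect r g"
  and trisect_diff: "trisect r (f - g) = trisect r f - trisect r g"
  by (simp_all add: fps_eq_iff)

text \<open>A series in \<open>q^3\<close> passes through trisection because it is supported on
  multiples of 3. The bound \<open>r < 3\<close> makes the multiples of 3 up to \<open>3*n+r\<close>
  exactly the \<open>3*j\<close> with \<open>j \<le> n\<close>.\<close>

lemma trisect_cubed_mult: "trisect r (cubed g * f) = g * trisect r f" if "r < 3"
proof (rule fps_ext)
  fix n
  have "trisect r (cubed g * f) $ n =
      (\<Sum>i=0..3*n+r. if 3 dvd i then g $ (i div 3) * f $ (3*n+r-i) else 0)"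
    by (auto simp: fps_mult_nth cubed_nth intro!: sum.cong)
  also have "\<dots> = (\<Sum>i\<in>{i\<in>{0..3*n+r}. 3 dvd i}. g $ (i div 3) * f $ (3*n+r-i))"
    by (rule sum.inter_filter [symmetric]) simp
  also have "{i\<in>{0..3*n+r}. 3 dvd i} = (\<lambda>j. 3 * j) ` {0..n}"
    using that by (auto simp: image_iff elim!: dvdE)
  also have "(\<Sum>i\<in>(\<lambda>j. 3 * j) ` {0..n}. g $ (i div 3) * f $ (3*n+r-i)) =
      (\<Sum>j=0..n. g $ j * f $ (3*n+r-3*j))"
    by (subst sum.reindex) (auto simp: inj_on_def)
  also have "\<dots> = (g * trisect r f) $ n"
    by (auto simp: fps_mult_nth algebra_simps intro!: sum.cong)
  finally show "trisect r (cubed g * f) $ n = (g * trisect r f) $ n" .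
qed

lemma trisect_numeral_mult: "trisect r (numeral k * f) = numeral k * trisect r f"
  by (simp add: fps_eq_iff numeral_fps_const)

lemma trisect_X_power:
  assumes "r < 3"
  shows "trisect r (fps_X ^ k) = (if k mod 3 = r then fps_X ^ (k div 3) else 0)"
  using assms by (auto simp: fps_eq_iff)

text \<open>Multiplication by \<open>fps_X\<close> rotates the residue classes, and wrapping from 2
  to 0 costs a factor \<open>fps_X\<close>. The index is written \<open>Suc 0\<close> because simp
  normalises 1 to it.\<close>

lemma trisect_X_mult:
  "trisect 0 (fps_X * f) = fps_X * trisect 2 f"
  "trisect (Suc 0) (fps_X * f) = trisect 0 f"
  "trisect 2 (fps_X * f) = trisect 1 f"
proof -
  show "trisect 0 (fps_X * f) = fps_X * trisect 2 f"
  proof (rule fps_ext)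
    show "trisect 0 (fps_X * f) $ n = (fps_X * trisect 2 f) $ n" for n
      by (cases n) simp_all
  qed
  show "trisect (Suc 0) (fps_X * f) = trisect 0 f"  "trisect 2 (fps_X * f) = trisect 1 f"
    by (simp_all add: fps_eq_iff)
qed

lemma trisect_X2_mult:
  "trisect 0 (fps_X ^ 2 * f) = fps_X * trisect 1 f"
  "trisect (Suc 0) (fps_X ^ 2 * f) = fps_X * trisect 2 f"
  "trisect 2 (fps_X ^ 2 * f) = trisect 0 f"
  by (simp_all add: power2_eq_square mult.assoc trisect_X_mult)

lemma trisect_cubed:
  assumes "r < 3"
  shows "trisect r (cubed g) = (if r = 0 then g else 0)"
  using trisect_cubed_mult [OF assms, of g 1] assms trisect_X_power [of r 0]
  by simp

lemma trisect_decomp: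
  "f = cubed (trisect 0 f) + fps_X * cubed (trisect 1 f) + fps_X ^ 2 * cubed (trisect 2 f)"
proof (rule fps_ext)
  fix n :: nat
  have "n = 3 * (n div 3) + n mod 3" "n mod 3 < 3" by simp_all
  then obtain m r where n: "n = 3 * m + r" "r < 3" by blast
  then have "r = 0 \<or> r = 1 \<or> r = 2" by auto
  then show "f $ n = (cubed (trisect 0 f) + fps_X * cubed (trisect 1 f) + fps_X ^ 2 * cubed (trisect 2 f)) $ n"
  proof (elim disjE)
    assume "r = 0"
    moreover have "\<not> 3 dvd 3 * m - 1" "\<not> 3 dvd 3 * m - 2" if "m > 0"
      using that by presburger+
    ultimately show ?thesis
      by (auto simp: n cubed_nth fps_X_power_mult_nth)
  next
    assume "r = 1"
    moreover have "\<not> 3 dvd Suc (3 * m) - 2" if "m > 0"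
      using that by presburger
    ultimately show ?thesis
      by (auto simp: n cubed_nth fps_X_power_mult_nth) presburger
  next
    assume "r = 2"
    then show ?thesis
      by (auto simp: n cubed_nth fps_X_power_mult_nth) presburger+
  qed
qed

text \<open>Power series form a free module over the series in \<open>q^3\<close> with basis 1, q,
  q^2; the factors \<open>fps_X\<close> come from reducing q^3 and q^4 to this basis.\<close>

lemma trisect_mult:
  "trisect 0 (f * g) = trisect 0 f * trisect 0 g
     + fps_X * (trisect 1 f * trisect 2 g + trisect 2 f * trisect 1 g)"
  "trisect 1 (f * g) = trisect 0 f * trisect 1 g + trisect 1 f * trisect 0 g
     + fps_X * (trisect 2 f * trisect 2 g)"
  "trisect 2 (f * g) = trisect 0 f * trisect 2 g + trisect 1 f * trisect 1 g
     + trisect 2 f * trisect 0 g"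
proof -
  have fg: "f * g = cubed (trisect 0 f) * g + cubed (trisect 1 f) * (fps_X * g)
      + cubed (trisect 2 f) * (fps_X ^ 2 * g)"
    by (subst trisect_decomp [of f]) (simp add: algebra_simps)
  show
    "trisect 0 (f * g) = trisect 0 f * trisect 0 g
       + fps_X * (trisect 1 f * trisect 2 g + trisect 2 f * trisect 1 g)"
    "trisect 1 (f * g) = trisect 0 f * trisect 1 g + trisect 1 f * trisect 0 g
       + fps_X * (trisect 2 f * trisect 2 g)"
    "trisect 2 (f * g) = trisect 0 f * trisect 2 g + trisect 1 f * trisect 1 g
       + trisect 2 f * trisect 0 g"
    unfolding fg trisect_add
    by (simp_all add: trisect_cubed_mult trisect_X_mult trisect_X2_mult) (simp_all add: algebra_simps)
qed

text \<open>With \<open>\<omega>\<close> a primitive cube root of unity, \<open>cubed (cubic_norm f)\<close> is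
  \<open>f(q) f(\<omega>q) f(\<omega>\<^sup>2q)\<close>.\<close>

definition cubic_norm :: "int fps \<Rightarrow> int fps" where
  "cubic_norm f = trisect 0 f ^ 3 + fps_X * trisect 1 f ^ 3 + fps_X ^ 2 * trisect 2 f ^ 3
     - 3 * fps_X * trisect 0 f * trisect 1 f * trisect 2 f"

text \<open>The norm is the determinant of multiplication by \<open>f\<close> on the free module
  with basis 1, q, q^2. Written out, its multiplicativity is a polynomial identity.\<close>

lemma cubic_norm_mult: "cubic_norm (f * g) = cubic_norm f * cubic_norm g"
proof -
  have "(a * a' + x * (b * c' + c * b')) ^ 3 + x * (a * b' + b * a' + x * (c * c')) ^ 3
      + x ^ 2 * (a * c' + b * b' + c * a') ^ 3
      - 3 * x * (a * a' + x * (b * c' + c * b')) * (a * b' + b * a' + x * (c * c'))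
          * (a * c' + b * b' + c * a') =
      (a ^ 3 + x * b ^ 3 + x ^ 2 * c ^ 3 - 3 * x * a * b * c) *
      (a' ^ 3 + x * b' ^ 3 + x ^ 2 * c' ^ 3 - 3 * x * a' * b' * c')"
    for a b c a' b' c' x :: "int fps"
    by algebra
  then show ?thesis
    unfolding cubic_norm_def trisect_mult .
qed

lemma cubic_norm_1 [simp]: "cubic_norm 1 = 1"
  using trisect_X_power [of _ 0] by (simp add: cubic_norm_def)

text \<open>If 3 divides \<open>k\<close>, the three conjugates of 1 - q^k coincide; otherwise their
  product is 1 - q^(3k).\<close>

lemma cubic_norm_1_minus_X_power:
  "cubic_norm (1 - fps_X ^ k) = (if 3 dvd k then (1 - fps_X ^ (k div 3)) ^ 3 else 1 - fps_X ^ k)"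
proof -
  have [simp]: "trisect r 1 = (if r = 0 then 1 else 0)" if "r < 3" for r
    using trisect_X_power [OF that, of 0] by auto
  have "k mod 3 < 3" by simp
  then consider "k mod 3 = 0" | "k mod 3 = 1" | "k mod 3 = 2" by linarith
  then show ?thesis
  proof cases
    case 1
    then show ?thesis
      by (auto simp: cubic_norm_def trisect_diff trisect_X_power)
  next
    case 2
    then have "k = Suc (k div 3 * 3)" using div_mult_mod_eq [of k 3] by linarith
    then have "fps_X * (fps_X ^ (k div 3)) ^ 3 = (fps_X ^ k :: int fps)"
      by (metis power_Suc power_mult)
    with 2 show ?thesis
      by (auto simp: cubic_norm_def trisect_diff trisect_X_power)
  next
    case 3
    then have "k = k div 3 * 3 + 2" using div_mult_mod_eq [of k 3] by linarith
    then have "fps_X ^ 2 * (fps_X ^ (k div 3)) ^ 3 = (fps_X ^ k :: int fps)"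
      by (metis power_add power_mult mult.commute)
    with 3 show ?thesis
      by (auto simp: cubic_norm_def trisect_diff trisect_X_power)
  qed
qed

section \<open>The theta function \<psi>\<close>

definition psi :: "int fps" where
  "psi = Abs_fps (\<lambda>n. if \<exists>k. n = k * (k + 1) div 2 then 1 else 0)"

section \<open>Gauss' product formula for psi\<close>

definition geom_inverse :: "nat \<Rightarrow> int fps" where
  "geom_inverse m = fps_right_inverse (1 - fps_X ^ m) 1"

lemma geom_inverse: "m > 0 \<Longrightarrow> (1 - fps_X ^ m) * geom_inverse m = 1"
  unfolding geom_inverse_def by (rule fps_right_inverse) auto

text \<open>A factor of Gauss' product, the quotient of 1 - q^(2k+2) by 1 - q^(2k+1).\<close>

definition psi_factor :: "nat \<Rightarrow> int fps" where
  "psi_factor k = (1 - fps_X ^ (2 * k + 2)) * geom_inverse (2 * k + 1)"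

definition psi_prod :: "nat \<Rightarrow> int fps" where
  "psi_prod n = (\<Prod>k<n. psi_factor k)"

lemma psi_factor: "psi_factor k * (1 - fps_X ^ (2 * k + 1)) = 1 - fps_X ^ (2 * k + 2)"
  using geom_inverse [of "2 * k + 1"] by (simp add: psi_factor_def mult_ac)

text \<open>The summand is the change in a term of the right-hand side of
  \<open>shanks_identity\<close> when \<open>n\<close> grows by one. The case \<open>m = n\<close>
  is the one needed; a general \<open>m\<close> makes the induction possible.\<close>

lemma shanks_telescope:
  assumes "m \<le> n"
  shows "(\<Sum>s<m. (\<Prod>k=s..<n. psi_factor k) * fps_X ^ (s * (2 * n + 1)) *
            (psi_factor n * fps_X ^ (2 * s) - 1)) =
         geom_inverse (2 * n + 1) * (1 - fps_X ^ (2 * m)) * (\<Prod>k=m..<n. psi_factor k)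
           * fps_X ^ (m * (2 * n + 1))"
  using assms
proof (induction m)
  case 0
  then show ?case by simp
next
  case (Suc m)
  define j x y w h h' where "j = geom_inverse (2 * n + 1)"
    and "x = (fps_X ^ (m * (2 * n + 1)) :: int fps)" and "y = (fps_X ^ (2 * m) :: int fps)"
    and "w = (fps_X ^ (2 * n + 1) :: int fps)"
    and "h = (\<Prod>k=m..<n. psi_factor k)" and "h' = (\<Prod>k=Suc m..<n. psi_factor k)"
  have pows: "fps_X ^ (Suc m * (2 * n + 1)) = x * w" "fps_X ^ (2 * Suc m) = fps_X ^ 2 * y"
    by (simp_all add: x_def w_def y_def flip: power_add power_Suc)
  have h: "h = psi_factor m * h'"
    using Suc.prems by (simp add: h_def h'_def prod.atLeast_Suc_lessThan)
  have fm: "psi_factor m * (1 - fps_X * y) = 1 - fps_X ^ 2 * y"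
    using psi_factor [of m] by (simp add: y_def power2_eq_square mult.assoc)
  have hh: "h * (1 - fps_X * y) = h' * (1 - fps_X ^ 2 * y)"
    unfolding h by (metis fm mult.assoc mult.commute)
  have fn: "psi_factor n = (1 - fps_X * w) * j"
    by (simp add: psi_factor_def w_def j_def)
  have jw: "(1 - w) * j = 1"
    using geom_inverse [of "2 * n + 1"] by (simp add: j_def w_def)
  have "(\<Sum>s<Suc m. (\<Prod>k=s..<n. psi_factor k) * fps_X ^ (s * (2 * n + 1)) *
            (psi_factor n * fps_X ^ (2 * s) - 1)) =
        j * (1 - y) * h * x + h * x * (psi_factor n * y - 1)"
    using Suc by (simp add: j_def x_def y_def w_def h_def)
  \<comment> \<open>Writing 1 as \<open>(1 - w) * j\<close> lets \<open>j\<close> factor out, and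
    what remains collapses to \<open>w * (1 - fps_X * y)\<close>.\<close>
  also have "\<dots> = j * (1 - y) * h * x + h * x * ((1 - fps_X * w) * j * y - (1 - w) * j)"
    by (simp only: fn jw)
  also have "\<dots> = j * x * w * (h * (1 - fps_X * y))"
    by (simp add: algebra_simps)
  also have "\<dots> = j * (1 - fps_X ^ (2 * Suc m)) * h' * fps_X ^ (Suc m * (2 * n + 1))"
    unfolding hh pows by (simp add: algebra_simps)
  finally show ?case by (simp only: j_def h'_def)
qed

text \<open>On the right, only the summand \<open>s = 0\<close> has terms of degree at most \<open>2n\<close>, and it is
  \<open>psi_prod n\<close>: this is Shanks' finite form of Gauss' product formula for \<open>\<psi>\<close>.\<close>

lemma shanks_identity:
  "(\<Sum>s<2*n. fps_X ^ (s * (s + 1) div 2)) =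
   (\<Sum>s<n. (\<Prod>k=s..<n. psi_factor k) * fps_X ^ (s * (2 * n + 1)))"
proof (induction n)
  case 0
  then show ?case by simp
next
  case (Suc n)
  define j x y where "j = geom_inverse (2 * n + 1)"
    and "x = (fps_X ^ (n * (2 * n + 1)) :: int fps)" and "y = (fps_X ^ (2 * n) :: int fps)"
  have jw: "(1 - fps_X * y) * j = 1"
    using geom_inverse [of "2 * n + 1"] by (simp add: j_def y_def)
  have fn: "psi_factor n = (1 - fps_X ^ 2 * y) * j"
    by (simp add: psi_factor_def y_def j_def power2_eq_square mult_ac)
  have split: "(\<Prod>k=s..<Suc n. psi_factor k) * fps_X ^ (s * (2 * Suc n + 1)) =
      (\<Prod>k=s..<n. psi_factor k) * fps_X ^ (s * (2 * n + 1))
      + (\<Prod>k=s..<n. psi_factor k) * fps_X ^ (s * (2 * n + 1)) *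
            (psi_factor n * fps_X ^ (2 * s) - 1)" if "s \<le> n" for s
  proof -
    have "s * (2 * Suc n + 1) = s * (2 * n + 1) + 2 * s" by simp
    with that show ?thesis
      by (simp only: power_add) (simp add: algebra_simps)
  qed
  have tri: "2 * n * (2 * n + 1) div 2 = n * (2 * n + 1)"
    "Suc (2 * n) * (Suc (2 * n) + 1) div 2 = n * (2 * n + 1) + (2 * n + 1)"
    by (simp_all add: algebra_simps)
  have "(\<Sum>s<Suc n. (\<Prod>k=s..<Suc n. psi_factor k) * fps_X ^ (s * (2 * Suc n + 1))) =
      (\<Sum>s<Suc n. (\<Prod>k=s..<n. psi_factor k) * fps_X ^ (s * (2 * n + 1)))
      + (\<Sum>s<Suc n. (\<Prod>k=s..<n. psi_factor k) * fps_X ^ (s * (2 * n + 1)) *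
            (psi_factor n * fps_X ^ (2 * s) - 1))"
    unfolding sum.distrib [symmetric] by (intro sum.cong refl split) auto
  \<comment> \<open>The summands \<open>s = n\<close>, whose products are empty, are split off from
    both sums; they give \<open>x\<close> and \<open>x * (psi_factor n * y - 1)\<close>.\<close>
  also have "\<dots> = (\<Sum>s<2*n. fps_X ^ (s * (s + 1) div 2)) + x
      + (j * (1 - y) * x + x * (psi_factor n * y - 1))"
    using shanks_telescope [of n n] unfolding Suc.IH sum.lessThan_Suc
    by (simp add: x_def y_def j_def)
  also have "j * (1 - y) * x + x * (psi_factor n * y - 1) =
      j * (1 - y) * x + x * ((1 - fps_X ^ 2 * y) * j * y - (1 - fps_X * y) * j)"
    by (simp only: fn jw)
  also have "\<dots> = x * (fps_X * y) * ((1 - fps_X * y) * j)"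
    by (simp add: algebra_simps power2_eq_square)
  also have "\<dots> = x * (fps_X * y)"
    by (simp only: jw mult_1_right)
  finally have step: "(\<Sum>s<Suc n. (\<Prod>k=s..<Suc n. psi_factor k) * fps_X ^ (s * (2 * Suc n + 1))) =
      (\<Sum>s<2*n. fps_X ^ (s * (s + 1) div 2)) + x + x * (fps_X * y)" .
  have "2 * Suc n = Suc (Suc (2 * n))" by simp
  then have "(\<Sum>s<2*Suc n. fps_X ^ (s * (s + 1) div 2)) =
      (\<Sum>s<2*n. fps_X ^ (s * (s + 1) div 2)) + x + x * (fps_X * y)"
    by (simp only: sum.lessThan_Suc tri power_add x_def y_def) simp
  then show ?case by (simp only: step)
qed

lemma triangular_inj:
  fixes k l :: nat
  assumes "k * (k + 1) div 2 = l * (l + 1) div 2"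
  shows "k = l"
proof -
  have mono: "a * (a + 1) div 2 < b * (b + 1) div 2" if "a < b" for a b :: nat
  proof -
    have "a * (a + 1) div 2 < Suc a * (Suc a + 1) div 2" by simp
    also have "\<dots> \<le> b * (b + 1) div 2"
      using that by (intro div_le_mono mult_le_mono) auto
    finally show ?thesis .
  qed
  show ?thesis
    using mono [of k l] mono [of l k] assms by (cases k l rule: linorder_cases) auto
qed

text \<open>In \<open>shanks_identity\<close>, the left side contains every triangular number below
  \<open>2 * n\<close> exactly once, and on the right each summand with \<open>s > 0\<close> starts
  beyond degree \<open>2 * n\<close>.\<close>

lemma psi_nth_eq_psi_prod_nth:
  assumes "i < 2 * n"
  shows "psi $ i = psi_prod n $ i"
proof -
  have le: "k \<le> k * (k + 1) div 2" for k :: nat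
    by (induction k) auto
  have "psi $ i = (\<Sum>s<2*n. if i = s * (s + 1) div 2 then 1 else 0)"
  proof (cases "\<exists>k. i = k * (k + 1) div 2")
    case True
    then obtain k where k: "i = k * (k + 1) div 2" by blast
    with le [of k] assms have "k < 2 * n" by simp
    have "(\<Sum>s<2*n. if i = s * (s + 1) div 2 then 1 else 0) = (\<Sum>s<2*n. if s = k then 1 else 0 :: int)"
      using triangular_inj k by (intro sum.cong refl) (metis (full_types))
    with \<open>k < 2 * n\<close> True show ?thesis by (simp add: psi_def)
  next
    case False
    then show ?thesis by (simp add: psi_def)
  qed
  also have "\<dots> = (\<Sum>s<2*n. fps_X ^ (s * (s + 1) div 2)) $ i"
    by (simp add: fps_sum_nth eq_commute)
  also have "\<dots> = (\<Sum>s<n. (\<Prod>k=s..<n. psi_factor k) * fps_X ^ (s * (2 * n + 1))) $ i"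
    by (simp only: shanks_identity)
  also have "\<dots> = (\<Sum>s<n. if s = 0 then psi_prod n $ i else 0)"
    unfolding fps_sum_nth
  proof (intro sum.cong refl)
    fix s
    show "((\<Prod>k=s..<n. psi_factor k) * fps_X ^ (s * (2 * n + 1))) $ i =
        (if s = 0 then psi_prod n $ i else 0)"
    proof (cases "s = 0")
      case True
      then show ?thesis by (simp add: psi_prod_def atLeast0LessThan)
    next
      case False
      then have "i < s * (2 * n + 1)"
        using assms by (cases s) auto
      with False show ?thesis by (simp only: fps_X_power_mult_right_nth) simp
    qed
  qed
  also have "\<dots> = psi_prod n $ i"
    using assms by simp
  finally show ?thesis .
qed

section \<open>Passage from finite products to the cubic norm of psi\<close>

definition agree_upto :: "nat \<Rightarrow> int fps \<Rightarrow> int fps \<Rightarrow> bool" where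
  "agree_upto n f g \<longleftrightarrow> (\<forall>i\<le>n. f $ i = g $ i)"

lemma agree_upto_mult:
  "agree_upto n f f' \<Longrightarrow> agree_upto n g g' \<Longrightarrow> agree_upto n (f * g) (f' * g')"
  unfolding agree_upto_def fps_mult_nth by (auto intro!: sum.cong)

lemma agree_upto_power: "agree_upto n f g \<Longrightarrow> agree_upto n (f ^ k) (g ^ k)"
  by (induction k) (simp_all add: agree_upto_mult, simp add: agree_upto_def)

lemma agree_upto_cubed: "agree_upto n f g \<Longrightarrow> agree_upto n (cubed f) (cubed g)"
  unfolding agree_upto_def cubed_nth by (auto intro: order.trans [OF div_le_dividend])

lemma agree_upto_trisect:
  "agree_upto (3 * n + 2) f g \<Longrightarrow> r < 3 \<Longrightarrow> agree_upto n (trisect r f) (trisect r g)"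
  unfolding agree_upto_def by auto

lemma agree_upto_add:
  "agree_upto n f f' \<Longrightarrow> agree_upto n g g' \<Longrightarrow> agree_upto n (f + g) (f' + g')"
  and agree_upto_diff:
  "agree_upto n f f' \<Longrightarrow> agree_upto n g g' \<Longrightarrow> agree_upto n (f - g) (f' - g')"
  and agree_upto_refl: "agree_upto n f f"
  unfolding agree_upto_def by auto

lemma agree_upto_cubic_norm:
  "agree_upto (3 * n + 2) f g \<Longrightarrow> agree_upto n (cubic_norm f) (cubic_norm g)"
  unfolding cubic_norm_def
  by (intro agree_upto_add agree_upto_diff agree_upto_mult agree_upto_power agree_upto_refl
      agree_upto_trisect) auto

text \<open>The norm keeps the factors with exponent prime to 3 and turns 1 - q^(3j) into (1 -
  q^j)^3; the \<open>cubed\<close> product restores the missing 1 - q^(3j).\<close>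

lemma cubic_norm_even_prod:
  "cubic_norm (\<Prod>k<3*n. 1 - fps_X ^ (2 * k + 2)) * cubed (\<Prod>k<n. 1 - fps_X ^ (2 * k + 2)) =
   (\<Prod>k<3*n. 1 - fps_X ^ (2 * k + 2)) * (\<Prod>k<n. 1 - fps_X ^ (2 * k + 2)) ^ 3"
proof (induction n)
  case 0
  then show ?case by simp
next
  case (Suc n)
  \<comment> \<open>Of the new exponents 6n+2, 6n+4, 6n+6 only the last is a multiple of 3.\<close>
  have nd: "\<not> 3 dvd 2 * (3 * n) + 2" "\<not> 3 dvd 2 * Suc (3 * n) + 2" by presburger+
  have e: "2 * Suc (Suc (3 * n)) + 2 = 3 * (2 * n + 2)" by simp
  have s: "3 * Suc n = Suc (Suc (Suc (3 * n)))" by simp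
  have norms: "cubic_norm (1 - fps_X ^ (2 * (3 * n) + 2)) = 1 - fps_X ^ (2 * (3 * n) + 2)"
    "cubic_norm (1 - fps_X ^ (2 * Suc (3 * n) + 2)) = 1 - fps_X ^ (2 * Suc (3 * n) + 2)"
    "cubic_norm (1 - fps_X ^ (2 * Suc (Suc (3 * n)) + 2)) = (1 - fps_X ^ (2 * n + 2)) ^ 3"
    unfolding cubic_norm_1_minus_X_power e using nd by simp_all
  have cub: "cubed (1 - fps_X ^ (2 * n + 2)) = 1 - fps_X ^ (2 * Suc (Suc (3 * n)) + 2)"
    unfolding e by (simp only: cubed_diff cubed_1 cubed_X_power)
  show ?case
    using arg_cong [OF Suc.IH, of "\<lambda>z. z * ((1 - fps_X ^ (2 * (3 * n) + 2)) *
      (1 - fps_X ^ (2 * Suc (3 * n) + 2)) * (1 - fps_X ^ (2 * Suc (Suc (3 * n)) + 2)) *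
      (1 - fps_X ^ (2 * n + 2)) ^ 3)"]
    unfolding s prod.lessThan_Suc cubic_norm_mult cubed_mult norms cub power_mult_distrib
    by (simp only: mult_ac)
qed

text \<open>The same bookkeeping for odd exponents: of 6n+1, 6n+3, 6n+5 the middle one is the
  multiple of 3.\<close>

lemma cubic_norm_odd_prod:
  "cubic_norm (\<Prod>k<3*n. 1 - fps_X ^ (2 * k + 1)) * cubed (\<Prod>k<n. 1 - fps_X ^ (2 * k + 1)) =
   (\<Prod>k<3*n. 1 - fps_X ^ (2 * k + 1)) * (\<Prod>k<n. 1 - fps_X ^ (2 * k + 1)) ^ 3"
proof (induction n)
  case 0
  then show ?case by simp
next
  case (Suc n)
  have nd: "\<not> 3 dvd 2 * (3 * n) + 1" "\<not> 3 dvd 2 * Suc (Suc (3 * n)) + 1" by presburger+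
  have e: "2 * Suc (3 * n) + 1 = 3 * (2 * n + 1)" by simp
  have s: "3 * Suc n = Suc (Suc (Suc (3 * n)))" by simp
  have norms: "cubic_norm (1 - fps_X ^ (2 * (3 * n) + 1)) = 1 - fps_X ^ (2 * (3 * n) + 1)"
    "cubic_norm (1 - fps_X ^ (2 * Suc (3 * n) + 1)) = (1 - fps_X ^ (2 * n + 1)) ^ 3"
    "cubic_norm (1 - fps_X ^ (2 * Suc (Suc (3 * n)) + 1)) = 1 - fps_X ^ (2 * Suc (Suc (3 * n)) + 1)"
    unfolding cubic_norm_1_minus_X_power e using nd by simp_all
  have cub: "cubed (1 - fps_X ^ (2 * n + 1)) = 1 - fps_X ^ (2 * Suc (3 * n) + 1)"
    unfolding e by (simp only: cubed_diff cubed_1 cubed_X_power)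
  show ?case
    using arg_cong [OF Suc.IH, of "\<lambda>z. z * ((1 - fps_X ^ (2 * (3 * n) + 1)) *
      (1 - fps_X ^ (2 * Suc (3 * n) + 1)) * (1 - fps_X ^ (2 * Suc (Suc (3 * n)) + 1)) *
      (1 - fps_X ^ (2 * n + 1)) ^ 3)"]
    unfolding s prod.lessThan_Suc cubic_norm_mult cubed_mult norms cub power_mult_distrib
    by (simp only: mult_ac)
qed

lemma psi_prod_mult_odd_prod:
  "psi_prod n * (\<Prod>k<n. 1 - fps_X ^ (2 * k + 1)) = (\<Prod>k<n. 1 - fps_X ^ (2 * k + 2))"
  unfolding psi_prod_def prod.distrib [symmetric] psi_factor ..

lemma one_minus_X_power_prod_neq_0:
  "(\<And>k. k \<in> A \<Longrightarrow> h k > 0) \<Longrightarrow> finite A \<Longrightarrow> (\<Prod>k\<in>A. 1 - fps_X ^ h k :: int fps) \<noteq> 0"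
proof -
  assume pos: "\<And>k. k \<in> A \<Longrightarrow> h k > 0" and "finite A"
  have "1 - fps_X ^ h k \<noteq> (0 :: int fps)" if "k \<in> A" for k
  proof
    assume "1 - fps_X ^ h k = (0 :: int fps)"
    then have "(1 - fps_X ^ h k) $ 0 = (0 :: int)" by simp
    with pos [OF that] show False by simp
  qed
  with \<open>finite A\<close> show ?thesis by simp
qed

text \<open>This is the quotient of the even identity by the odd one. The odd products are cancelled
  as nonzero elements of an integral domain.\<close>

lemma cubic_norm_psi_prod:
  "cubic_norm (psi_prod (3 * n)) * cubed (psi_prod n) = psi_prod (3 * n) * psi_prod n ^ 3"
proof -
  define O3 O1 E3 E1 where "O3 = (\<Prod>k<3*n. 1 - fps_X ^ (2 * k + 1) :: int fps)"
    and "O1 = (\<Prod>k<n. 1 - fps_X ^ (2 * k + 1) :: int fps)"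
    and "E3 = (\<Prod>k<3*n. 1 - fps_X ^ (2 * k + 2) :: int fps)"
    and "E1 = (\<Prod>k<n. 1 - fps_X ^ (2 * k + 2) :: int fps)"
  have P: "psi_prod (3 * n) * O3 = E3" "psi_prod n * O1 = E1"
    by (simp_all only: psi_prod_mult_odd_prod O3_def O1_def E3_def E1_def)
  have N: "cubic_norm E3 * cubed E1 = E3 * E1 ^ 3" "cubic_norm O3 * cubed O1 = O3 * O1 ^ 3"
    using cubic_norm_even_prod [of n] cubic_norm_odd_prod [of n]
    by (simp_all only: O3_def O1_def E3_def E1_def)
  have nz: "O3 \<noteq> 0" "O1 \<noteq> 0"
    unfolding O3_def O1_def by (rule one_minus_X_power_prod_neq_0; simp)+
  have "(cubic_norm (psi_prod (3 * n)) * cubed (psi_prod n)) * (O3 * O1 ^ 3) =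
      cubic_norm (psi_prod (3 * n) * O3) * cubed (psi_prod n * O1)"
    unfolding N(2) [symmetric] cubic_norm_mult cubed_mult by (simp only: mult_ac)
  also have "\<dots> = (psi_prod (3 * n) * psi_prod n ^ 3) * (O3 * O1 ^ 3)"
    unfolding P N(1) by (simp add: P [symmetric] power_mult_distrib mult_ac)
  finally show ?thesis using nz by simp
qed

lemma cubic_norm_psi: "cubic_norm psi * cubed psi = psi ^ 4"
proof (rule fps_ext)
  fix n :: nat
  \<comment> \<open>Coefficient \<open>n\<close> of the norm involves psi up to degree
    \<open>3 * n + 2\<close>, and \<open>psi_prod m\<close> agrees with psi below degree
    \<open>2 * m\<close>; \<open>2 * ?N\<close> exceeds that bound.\<close>
  let ?N = "2 * n + 2"
  have a: "agree_upto (3 * n + 2) psi (psi_prod m)" if "m \<ge> ?N" for m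
    using that by (auto simp: agree_upto_def intro!: psi_nth_eq_psi_prod_nth)
  then have b: "agree_upto n psi (psi_prod m)" if "m \<ge> ?N" for m
    using that by (fastforce simp: agree_upto_def)
  have "agree_upto n (cubic_norm psi * cubed psi)
      (cubic_norm (psi_prod (3 * ?N)) * cubed (psi_prod ?N))"
    by (intro agree_upto_mult agree_upto_cubic_norm agree_upto_cubed a b) auto
  moreover have "agree_upto n (psi * psi ^ 3) (psi_prod (3 * ?N) * psi_prod ?N ^ 3)"
    by (intro agree_upto_mult agree_upto_power b) auto
  ultimately have "(cubic_norm psi * cubed psi) $ n = (psi * psi ^ 3) $ n"
    unfolding cubic_norm_psi_prod by (simp add: agree_upto_def)
  also have "psi * psi ^ 3 = psi ^ 4"
    by (simp flip: power_Suc)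
  finally show "(cubic_norm psi * cubed psi) $ n = (psi ^ 4) $ n" .
qed

text \<open>With T(k) = k(k+1)/2, T(k) is a multiple of 3 unless k = 3m+1, and T(3m+1) = 9 T(m) + 1.
  The proof works with 2 T(k) to avoid division.\<close>

lemma trisect_1_psi: "trisect 1 psi = cubed psi"
  and trisect_2_psi: "trisect 2 psi = 0"
proof -
  have tri: "n = k * (k + 1) div 2 \<longleftrightarrow> 2 * n = k * (k + 1)" for n k :: nat
    by (metis dvd_mult_div_cancel even_mult_iff even_plus_one_iff nonzero_mult_div_cancel_left
        zero_neq_numeral)
  have mod3: "(\<exists>j. k * (k + 1) = 3 * j) \<or> (\<exists>m. k * (k + 1) = 9 * (m * (m + 1)) + 2)" for k :: nat
  proof -
    obtain m where "k = 3 * m \<or> k = 3 * m + 1 \<or> k = 3 * m + 2"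
      by (rule that [of "k div 3"]) presburger
    then have "k * (k + 1) = 3 * (m * (3 * m + 1)) \<or> k * (k + 1) = 9 * (m * (m + 1)) + 2 \<or>
        k * (k + 1) = 3 * ((3 * m + 2) * (m + 1))"
      by (elim disjE) (simp_all add: algebra_simps)
    then show ?thesis by blast
  qed
  show "trisect 2 psi = 0"
  proof (rule fps_ext)
    fix n :: nat
    have "2 * (3 * n + 2) \<noteq> k * (k + 1)" for k
    proof -
      have "2 * (3 * n + 2) \<noteq> 3 * j" "2 * (3 * n + 2) \<noteq> 9 * j + 2" for j
        by presburger+
      then show ?thesis using mod3 [of k] by metis
    qed
    then show "trisect 2 psi $ n = 0 $ n"
      unfolding trisect_nth psi_def fps_nth_Abs_fps tri by simp
  qed
  show "trisect 1 psi = cubed psi"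
  proof (rule fps_ext)
    fix n :: nat
    have "(\<exists>k. 2 * (3 * n + 1) = k * (k + 1)) \<longleftrightarrow> 3 dvd n \<and> (\<exists>k. 2 * (n div 3) = k * (k + 1))"
    proof (intro iffI conjI)
      assume "\<exists>k. 2 * (3 * n + 1) = k * (k + 1)"
      moreover have "2 * (3 * n + 1) \<noteq> 3 * j" for j
        by presburger
      ultimately obtain m where "2 * (3 * n + 1) = 9 * (m * (m + 1)) + 2"
        using mod3 by metis
      then have "2 * n = 3 * (m * (m + 1))" by simp
      then have "3 dvd n \<and> 2 * (n div 3) = m * (m + 1)"
        unfolding atomize_conj by presburger
      then show "3 dvd n" "\<exists>k. 2 * (n div 3) = k * (k + 1)"
        by blast+
    next
      assume "3 dvd n \<and> (\<exists>k. 2 * (n div 3) = k * (k + 1))"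
      then obtain m k where "n = 3 * m" "2 * m = k * (k + 1)" by auto
      then show "\<exists>k. 2 * (3 * n + 1) = k * (k + 1)"
        \<comment> \<open>The witness satisfies (3k+1)(3k+2) = 9k(k+1) + 2.\<close>
        by (intro exI [of _ "3 * k + 1"]) (simp add: algebra_simps)
    qed
    then show "trisect 1 psi $ n = cubed psi $ n"
      unfolding trisect_nth psi_def cubed_nth fps_nth_Abs_fps tri by simp
  qed
qed

section \<open>Partitions with distinct odd parts\<close>

definition pod_partitions :: "nat \<Rightarrow> nat multiset set" where
  "pod_partitions n = {p. odd_distinct_partition p \<and> sum_mset p = n}"

text \<open>The bound allows recursion on the largest admissible part, and it is vacuous once
  \<open>m \<ge> n\<close>.\<close>

definition bounded_pod_partitions :: "nat \<Rightarrow> nat \<Rightarrow> nat multiset set" where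
  "bounded_pod_partitions m n = {p \<in> pod_partitions n. set_mset p \<subseteq> {..m}}"

lemma finite_pod_partitions: "finite (pod_partitions n)"
proof -
  have "(\<lambda>p. [p]) ` pod_partitions n \<subseteq> pod_tuples 1 n"
    by (auto simp: pod_partitions_def pod_tuples_def)
  then have "finite ((\<lambda>p. [p]) ` pod_partitions n)"
    using finite_pod_tuples finite_subset by blast
  then show ?thesis
    by (rule finite_imageD) (auto simp: inj_on_def)
qed

lemma finite_bounded_pod_partitions: "finite (bounded_pod_partitions m n)"
  using finite_pod_partitions by (simp add: bounded_pod_partitions_def)

lemma bounded_pod_partitions_eq:
  assumes "n \<le> m"
  shows "bounded_pod_partitions m n = pod_partitions n"
proof -
  have "i \<le> m" if "sum_mset p = n" "i \<in># p" for p i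
    using sum_mset.remove [OF that(2)] that(1) assms by simp
  then show ?thesis
    by (auto simp: bounded_pod_partitions_def pod_partitions_def)
qed

lemma bounded_pod_partitions_0: "bounded_pod_partitions 0 n = (if n = 0 then {{#}} else {})"
proof -
  have "p = {#}" if "p \<in> bounded_pod_partitions 0 n" for p
  proof -
    from that have "0 \<notin># p" "set_mset p \<subseteq> {0}"
      by (auto simp: bounded_pod_partitions_def pod_partitions_def odd_distinct_partition_def)
    then have "set_mset p = {}" by blast
    then show ?thesis by simp
  qed
  moreover have "{#} \<in> bounded_pod_partitions 0 n \<longleftrightarrow> n = 0"
    by (auto simp: bounded_pod_partitions_def pod_partitions_def odd_distinct_partition_def)
  ultimately show ?thesis by auto
qed

text \<open>An odd part occurs at most once, so removing it lowers the bound on the parts.\<close>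

lemma card_bounded_pod_partitions_Suc:
  "card (bounded_pod_partitions (Suc m) n) = card (bounded_pod_partitions m n) +
     (if Suc m \<le> n then card (bounded_pod_partitions (if odd (Suc m) then m else Suc m) (n - Suc m)) else 0)"
proof -
  define l where "l = (if odd (Suc m) then m else Suc m)"
  let ?S = "{p \<in> bounded_pod_partitions (Suc m) n. Suc m \<in># p}"
  have "bounded_pod_partitions (Suc m) n = bounded_pod_partitions m n \<union> ?S"
    by (auto simp: bounded_pod_partitions_def le_Suc_eq)
  moreover have "bounded_pod_partitions m n \<inter> ?S = {}"
    by (auto simp: bounded_pod_partitions_def)
  ultimately have "card (bounded_pod_partitions (Suc m) n) = card (bounded_pod_partitions m n) + card ?S"
    using finite_bounded_pod_partitions
    by (metis (no_types, lifting) card_Un_disjoint finite_Un)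
  moreover have "card ?S = (if Suc m \<le> n then card (bounded_pod_partitions l (n - Suc m)) else 0)"
  proof (cases "Suc m \<le> n")
    case True
    have "bij_betw (add_mset (Suc m)) (bounded_pod_partitions l (n - Suc m)) ?S"
    proof (rule bij_betw_byWitness [where f' = "\<lambda>p. p - {#Suc m#}"])
      show "\<forall>p\<in>bounded_pod_partitions l (n - Suc m). add_mset (Suc m) p - {#Suc m#} = p"
        by simp
      show "\<forall>p\<in>?S. add_mset (Suc m) (p - {#Suc m#}) = p"
        by simp
      show "add_mset (Suc m) ` bounded_pod_partitions l (n - Suc m) \<subseteq> ?S"
      proof clarify
        fix p assume p: "p \<in> bounded_pod_partitions l (n - Suc m)"
        have "count p (Suc m) = 0" if "odd (Suc m)"
        proof -
          have "Suc m \<notin># p"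
            using p that by (auto simp: bounded_pod_partitions_def l_def)
          then show ?thesis by (simp add: not_in_iff)
        qed
        moreover have "set_mset p \<subseteq> {..Suc m}"
          using p by (fastforce simp: bounded_pod_partitions_def l_def split: if_splits)
        ultimately show "add_mset (Suc m) p \<in> bounded_pod_partitions (Suc m) n \<and> Suc m \<in># add_mset (Suc m) p"
          using p True
          by (auto simp: bounded_pod_partitions_def pod_partitions_def odd_distinct_partition_def)
      qed
      show "(\<lambda>p. p - {#Suc m#}) ` ?S \<subseteq> bounded_pod_partitions l (n - Suc m)"
      proof clarify
        fix p assume p: "p \<in> bounded_pod_partitions (Suc m) n" "Suc m \<in># p"
        obtain r where r: "p = add_mset (Suc m) r"
          using p(2) by (metis insert_DiffM)
        have "odd_distinct_partition p" "sum_mset p = n" "set_mset p \<subseteq> {..Suc m}"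
          using p(1) by (auto simp: bounded_pod_partitions_def pod_partitions_def)
        then have pos: "\<forall>i\<in>#r. 0 < i" and one: "\<And>i. i \<in># p \<Longrightarrow> odd i \<Longrightarrow> count p i = 1"
          and sum: "sum_mset r = n - Suc m" and sub: "set_mset r \<subseteq> {..Suc m}"
          by (auto simp: r odd_distinct_partition_def)
        have "count r i = 1" if "i \<in># r" "odd i" for i
          using one [of i] that by (auto simp: r count_eq_zero_iff split: if_splits)
        moreover have "Suc m \<notin># r" if "odd (Suc m)"
          using one [of "Suc m"] that by (simp add: r count_eq_zero_iff)
        then have "set_mset r \<subseteq> {..l}"
          using sub by (auto simp: l_def le_Suc_eq subset_iff) 
        ultimately show "p - {#Suc m#} \<in> bounded_pod_partitions l (n - Suc m)"
          using pos sum
          by (auto simp: r bounded_pod_partitions_def pod_partitions_def odd_distinct_partition_def)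
      qed
    qed
    with True show ?thesis by (simp add: bij_betw_same_card)
  next
    case False
    have "?S = {}"
    proof -
      have "Suc m \<le> n" if "sum_mset p = n" "Suc m \<in># p" for p
        using sum_mset.remove [OF that(2)] that(1) by simp
      with False show ?thesis
        by (auto simp: bounded_pod_partitions_def pod_partitions_def)
    qed
    with False show ?thesis by (simp only: card.empty if_False)
  qed
  ultimately show ?thesis by (simp add: l_def)
qed

text \<open>The sign substitutes -q for q, so an odd part i contributes a factor 1 - q^i and an even
  part i a factor 1/(1 - q^i).\<close>

definition bounded_pod_gf :: "nat \<Rightarrow> int fps" where
  "bounded_pod_gf m = Abs_fps (\<lambda>n. (-1) ^ n * int (card (bounded_pod_partitions m n)))"

definition pod_gf :: "int fps" where
  "pod_gf = Abs_fps (\<lambda>n. (-1) ^ n * int (card (pod_partitions n)))"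

definition pod_tuples_gf :: "nat \<Rightarrow> int fps" where
  "pod_tuples_gf k = Abs_fps (\<lambda>n. (-1) ^ n * int (pod_neg k n))"

lemma bounded_pod_gf_0: "bounded_pod_gf 0 = 1"
  by (simp add: fps_eq_iff bounded_pod_gf_def bounded_pod_partitions_0)

lemma bounded_pod_gf_Suc_odd:
  assumes "odd (Suc m)"
  shows "bounded_pod_gf (Suc m) = (1 - fps_X ^ Suc m) * bounded_pod_gf m"
proof (rule fps_ext)
  fix n
  have sgn: "(-1) ^ n = - ((-1) ^ (n - Suc m) :: int)" if "Suc m \<le> n"
    using assms that by (metis le_add_diff_inverse mult_minus1 power_add power_minus_odd power_one)
  have "bounded_pod_gf (Suc m) $ n = bounded_pod_gf m $ n - (fps_X ^ Suc m * bounded_pod_gf m) $ n"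
    unfolding fps_X_power_mult_nth
    using assms sgn
    by (auto simp: bounded_pod_gf_def card_bounded_pod_partitions_Suc distrib_left)
  also have "\<dots> = ((1 - fps_X ^ Suc m) * bounded_pod_gf m) $ n"
    by (simp only: left_diff_distrib mult_1_left fps_sub_nth)
  finally show "bounded_pod_gf (Suc m) $ n = ((1 - fps_X ^ Suc m) * bounded_pod_gf m) $ n" .
qed

lemma bounded_pod_gf_Suc_even:
  assumes "even (Suc m)"
  shows "(1 - fps_X ^ Suc m) * bounded_pod_gf (Suc m) = bounded_pod_gf m"
proof (rule fps_ext)
  fix n
  have sgn: "(-1) ^ n = ((-1) ^ (n - Suc m) :: int)" if "Suc m \<le> n"
    using assms that by (metis le_add_diff_inverse mult_1 power_add power_minus_even power_one)
  have "bounded_pod_gf (Suc m) $ n = bounded_pod_gf m $ n + (fps_X ^ Suc m * bounded_pod_gf (Suc m)) $ n"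
    unfolding fps_X_power_mult_nth
    using assms sgn card_bounded_pod_partitions_Suc [of m n]
    by (auto simp: bounded_pod_gf_def distrib_left)
  then show "((1 - fps_X ^ Suc m) * bounded_pod_gf (Suc m)) $ n = bounded_pod_gf m $ n"
    by (simp only: left_diff_distrib mult_1_left fps_sub_nth)
qed

text \<open>Admitting the parts \<open>2 * n + 1\<close> and \<open>2 * n + 2\<close> divides the
  generating function by \<open>psi_factor n\<close>.\<close>

lemma bounded_pod_gf_mult_psi_prod: "bounded_pod_gf (2 * n) * psi_prod n = 1"
proof (induction n)
  case 0
  then show ?case by (simp add: bounded_pod_gf_0 psi_prod_def)
next
  case (Suc n)
  let ?b = "bounded_pod_gf (2 * n + 2)"
  have "(1 - fps_X ^ (2 * n + 2)) * ?b = (1 - fps_X ^ (2 * n + 1)) * bounded_pod_gf (2 * n)"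
    using bounded_pod_gf_Suc_even [of "2 * n + 1"] bounded_pod_gf_Suc_odd [of "2 * n"] by simp
  then have "?b * psi_factor n = geom_inverse (2 * n + 1) * ((1 - fps_X ^ (2 * n + 1)) * bounded_pod_gf (2 * n))"
    by (simp add: psi_factor_def mult_ac)
  also have "\<dots> = ((1 - fps_X ^ (2 * n + 1)) * geom_inverse (2 * n + 1)) * bounded_pod_gf (2 * n)"
    by (simp only: mult_ac)
  also have "\<dots> = bounded_pod_gf (2 * n)"
    by (subst geom_inverse) simp_all
  finally have "?b * (psi_factor n * psi_prod n) = 1"
    by (simp add: Suc.IH flip: mult.assoc)
  then show ?case
    by (simp add: psi_prod_def mult_ac)
qed

lemma pod_gf_mult_psi: "pod_gf * psi = 1"
proof (rule fps_ext)
  fix n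
  let ?m = "Suc n"
  have "agree_upto n pod_gf (bounded_pod_gf (2 * ?m))"
    by (simp add: agree_upto_def pod_gf_def bounded_pod_gf_def bounded_pod_partitions_eq)
  moreover have "agree_upto n psi (psi_prod ?m)"
    by (auto simp: agree_upto_def intro: psi_nth_eq_psi_prod_nth)
  ultimately have "agree_upto n (pod_gf * psi) (bounded_pod_gf (2 * ?m) * psi_prod ?m)"
    by (rule agree_upto_mult)
  then show "(pod_gf * psi) $ n = 1 $ n"
    unfolding bounded_pod_gf_mult_psi_prod by (simp add: agree_upto_def)
qed

lemma pod_neg_Suc: "pod_neg (Suc k) n = (\<Sum>i\<le>n. card (pod_partitions i) * pod_neg k (n - i))"
proof -
  let ?T = "\<lambda>i. (\<lambda>(p, ps). p # ps) ` (pod_partitions i \<times> pod_tuples k (n - i))"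
  have "pod_tuples (Suc k) n = (\<Union>i\<le>n. ?T i)"
    by (auto simp: pod_tuples_def pod_partitions_def length_Suc_conv image_iff)
  then have "pod_neg (Suc k) n = card (\<Union>i\<le>n. ?T i)"
    by (simp add: pod_neg_def)
  also have "\<dots> = (\<Sum>i\<le>n. card (?T i))"
  proof (intro card_UN_disjoint ballI impI)
    show "finite (?T i)" for i
      by (intro finite_imageI finite_cartesian_product finite_pod_partitions finite_pod_tuples)
  qed (auto simp: pod_partitions_def)
  also have "\<dots> = (\<Sum>i\<le>n. card (pod_partitions i) * pod_neg k (n - i))"
    by (intro sum.cong refl, subst card_image) (auto simp: inj_on_def card_cartesian_product pod_neg_def)
  finally show ?thesis .
qed

lemma pod_tuples_gf_eq: "pod_tuples_gf k = pod_gf ^ k"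
proof (induction k)
  case 0
  have "pod_tuples 0 n = (if n = 0 then {[]} else {})" for n
    by (auto simp: pod_tuples_def)
  then show ?case
    by (simp add: fps_eq_iff pod_tuples_gf_def pod_neg_def)
next
  case (Suc k)
  have "pod_tuples_gf (Suc k) = pod_gf * pod_tuples_gf k"
  proof (rule fps_ext)
    fix n
    have "pod_tuples_gf (Suc k) $ n =
        (\<Sum>i\<le>n. (-1) ^ n * (int (card (pod_partitions i)) * int (pod_neg k (n - i))))"
      by (simp add: pod_tuples_gf_def pod_neg_Suc sum_distrib_left)
    also have "\<dots> = (\<Sum>i\<le>n. pod_gf $ i * pod_tuples_gf k $ (n - i))"
    proof (intro sum.cong refl)
      fix i assume "i \<in> {..n}"
      then have "(-1) ^ n = (-1) ^ i * ((-1) ^ (n - i) :: int)"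
        by (simp flip: power_add)
      then show "(-1) ^ n * (int (card (pod_partitions i)) * int (pod_neg k (n - i))) =
          pod_gf $ i * pod_tuples_gf k $ (n - i)"
        by (simp add: pod_gf_def pod_tuples_gf_def)
    qed
    finally show "pod_tuples_gf (Suc k) $ n = (pod_gf * pod_tuples_gf k) $ n"
      by (simp add: fps_mult_nth atLeast0AtMost)
  qed
  with Suc.IH show ?case by simp
qed

section \<open>Trisections of powers of \<open>1/\<psi>\<close>\<close>

text \<open>Here \<open>S\<close> is the cubic norm of psi, whose class 2 part vanishes.
  \<open>X\<close> stays a plain variable in the ring identities, hence the rules folded with
  \<open>X_def\<close>.\<close>

context
  fixes F P A B S h X :: "int fps"
  defines "F \<equiv> pod_gf" and "P \<equiv> psi" and "A \<equiv> trisect 0 psi" and "B \<equiv> cubed psi"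
    and "X \<equiv> fps_X" and "S \<equiv> A ^ 3 + X * B ^ 3" and "h \<equiv> F ^ 4 * B"
begin

lemmas trisect_mult_X = trisect_mult [folded X_def]

lemma F_psi: "F * P = 1"
  by (simp add: F_def P_def pod_gf_mult_psi)

lemma S_B: "S * B = P ^ 4"
  using cubic_norm_psi trisect_1_psi trisect_2_psi by (simp add: cubic_norm_def S_def A_def B_def P_def X_def)

text \<open>This unit is used to pad polynomials in \<open>A\<close> and \<open>B\<close> to a
  common degree: after substituting \<open>S\<close> they become polynomial identities, and then the
  unit is set to 1.\<close>

lemma F4_S_B: "F ^ 4 * S * B = 1"
  by (simp add: mult.assoc S_B F_psi flip: power_mult_distrib)

text \<open>Trisecting \<open>B ^ k * f\<close> turns \<open>B ^ k\<close> into
  \<open>P ^ k\<close>, which cancels against powers of \<open>F\<close>.\<close>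

lemma F_power_psi_power: "F ^ (m + n) * P ^ n = F ^ m"
  by (simp add: power_add mult.assoc F_psi flip: power_mult_distrib)

text \<open>With psi = a + q b, this is 1/(a + q b) = (a^2 - q a b + q^2 b^2)/(a^3 + q^3 b^3);
  \<open>cubed h\<close> is the inverse of the denominator.\<close>

lemma F_decomp:
  "F = cubed h * (cubed (A ^ 2) + X * cubed (- (A * B)) + X ^ 2 * cubed (B ^ 2))"
    (is "F = ?R")
proof -
  define a b where "a = cubed A" and "b = cubed B"
  have P: "P = a + X * b"
    using trisect_decomp [of psi] trisect_1_psi trisect_2_psi
    by (simp add: P_def A_def B_def X_def a_def b_def cubed_def)
  have R: "?R = cubed h * (a ^ 2 + X * - (a * b) + X ^ 2 * b ^ 2)"
    by (simp add: a_def b_def cubed_def fps_compose_uminus fps_compose_mult_distrib fps_compose_power)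
  have "?R * P = cubed h * (a ^ 3 + X ^ 3 * b ^ 3)"
    unfolding P R by (simp add: algebra_simps power2_eq_square power3_eq_cube)
  also have "\<dots> = cubed (F ^ 4 * S * B)"
    by (simp add: S_def h_def a_def b_def X_def cubed_mult cubed_add cubed_power cubed_X mult_ac)
  finally have "?R * P = 1"
    by (simp add: F4_S_B)
  then have "F = F * (?R * P)" by simp
  also have "\<dots> = ?R * (F * P)" by (simp only: mult_ac)
  finally show ?thesis by (simp add: F_psi)
qed

lemma trisect_F:
  "trisect 0 F = h * A ^ 2"
  "trisect 1 F = - (h * (A * B))"
  "trisect 2 F = h * B ^ 2"
  by (subst F_decomp, simp add: trisect_cubed_mult trisect_add
      trisect_X_mult [folded X_def] trisect_X2_mult [folded X_def]
      trisect_cubed)+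

lemma trisect_F2:
  "trisect 0 (F ^ 2) = h ^ 2 * (A ^ 4 - 2 * X * A * B ^ 3)"
  "trisect 1 (F ^ 2) = h ^ 2 * (X * B ^ 4 - 2 * A ^ 3 * B)"
  "trisect 2 (F ^ 2) = 3 * (h ^ 2 * A ^ 2 * B ^ 2)"
  unfolding power2_eq_square [of F] trisect_mult_X trisect_F by algebra+

lemma F_power_4: "F ^ 4 = F ^ 2 * F ^ 2"
  by (simp flip: power_add)

lemma trisect_F4:
  "trisect 0 (F ^ 4) = h ^ 4 * (A ^ 8 - 16 * X * A ^ 5 * B ^ 3 + 10 * X ^ 2 * A ^ 2 * B ^ 6)"
  "trisect 1 (F ^ 4) = h ^ 4 * (- 4 * A ^ 7 * B + 19 * X * A ^ 4 * B ^ 4 - 4 * X ^ 2 * A * B ^ 7)"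
  "trisect 2 (F ^ 4) = h ^ 4 * (10 * A ^ 6 * B ^ 2 - 16 * X * A ^ 3 * B ^ 5 + X ^ 2 * B ^ 8)"
  unfolding F_power_4 trisect_mult_X trisect_F2 by algebra+

text \<open>Class 2 of \<open>F ^ 4\<close> is \<open>h ^ 4 * B ^ 2\<close> times a polynomial in
  \<open>A ^ 3\<close> and \<open>X * B ^ 3\<close>, so \<open>A ^ 3 = S - X * B ^ 3\<close>
  eliminates \<open>A\<close>.\<close>

lemma trisect_2_F4:
  "trisect 2 (F ^ 4) = 10 * (B ^ 4 * F ^ 8) - 36 * (X * B ^ 8 * F ^ 12) + 27 * (X ^ 2 * B ^ 12 * F ^ 16)"
proof -
  have "trisect 2 (F ^ 4) = 10 * (B ^ 4 * F ^ 8) * (F ^ 4 * S * B) ^ 2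
      - 36 * (X * B ^ 8 * F ^ 12) * (F ^ 4 * S * B) + 27 * (X ^ 2 * B ^ 12 * F ^ 16)"
    unfolding trisect_F4 S_def h_def by algebra
  then show ?thesis by (simp add: F4_S_B)
qed

text \<open>The cofactor of \<open>F ^ 12 * B ^ 4\<close> is homogeneous of degree 5 in the unit
  \<open>e\<close> and in \<open>t\<close>; its terms from \<open>t ^ 3\<close> on have coefficients
  divisible by 81.\<close>

lemma trisect_1_F8:
  "\<exists>Z. trisect 1 (F ^ 8) = - 8 * (F ^ 12 * B ^ 4) + 306 * (X * F ^ 16 * B ^ 8)
     - 2160 * (X ^ 2 * F ^ 20 * B ^ 12) + 81 * Z"
proof -
  have F8: "F ^ 8 = F ^ 4 * F ^ 4" by (simp flip: power_add)
  define e t where "e = F ^ 4 * S * B" and "t = X * F ^ 4 * B ^ 4"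
  have "trisect 1 (F ^ 8) = F ^ 12 * B ^ 4 *
      (- 8 * e ^ 5 + 306 * e ^ 4 * t - 2160 * e ^ 3 * t ^ 2
        + 81 * (68 * e ^ 2 * t ^ 3 - 72 * e * t ^ 4 + 27 * t ^ 5))"
    unfolding F8 trisect_mult_X trisect_F4 S_def h_def e_def t_def by algebra
  also have "\<dots> = - 8 * (F ^ 12 * B ^ 4) + 306 * (X * F ^ 16 * B ^ 8)
     - 2160 * (X ^ 2 * F ^ 20 * B ^ 12) + 81 * (F ^ 12 * B ^ 4 * (68 * t ^ 3 - 72 * t ^ 4 + 27 * t ^ 5))"
    unfolding e_def F4_S_B power_one mult_1_right unfolding t_def by algebra
  finally show ?thesis by blast
qed

text \<open>Cubing makes classes 1 and 2 divisible by 3. In products, their contributions to class 0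
  carry two factors 3, which preserves the congruence modulo 9.\<close>

lemma trisect_F3k:
  "9 dvd trisect 0 (F ^ (3 * k)) - h ^ k \<and>
   3 dvd trisect 1 (F ^ (3 * k)) \<and> 3 dvd trisect 2 (F ^ (3 * k))"
proof (induction k)
  case 0
  then show ?case
    using trisect_X_power [of _ 0] by simp
next
  case (Suc k)
  have F3: "F ^ 3 = F ^ 2 * F" by (simp add: power_numeral_reduce)
  \<comment> \<open>The polynomial in \<open>A\<close> and \<open>B\<close> here is
    \<open>S ^ 2 - 9 * X * A ^ 3 * B ^ 3\<close>.\<close>
  have "trisect 0 (F ^ 3) = h * (F ^ 4 * S * B) ^ 2 + 9 * (- X * h ^ 3 * A ^ 3 * B ^ 3)"
    unfolding F3 trisect_mult_X trisect_F2 trisect_F S_def h_def by algebra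
  then have "trisect 0 (F ^ 3) = h + 9 * (- X * h ^ 3 * A ^ 3 * B ^ 3)"
    by (simp add: F4_S_B)
  moreover have "trisect 1 (F ^ 3) = 3 * (h ^ 3 * (2 * X * A ^ 2 * B ^ 4 - A ^ 5 * B))"
    "trisect 2 (F ^ 3) = 3 * (h ^ 3 * (2 * A ^ 4 * B ^ 2 - X * A * B ^ 5))"
    unfolding F3 trisect_mult_X trisect_F2 trisect_F h_def by algebra+
  moreover obtain x y z where "trisect 0 (F ^ (3 * k)) = h ^ k + 9 * x"
    "trisect 1 (F ^ (3 * k)) = 3 * y" "trisect 2 (F ^ (3 * k)) = 3 * z"
    using Suc.IH by (metis dvdE diff_add_cancel add.commute)
  moreover have "F ^ (3 * Suc k) = F ^ 3 * F ^ (3 * k)"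
    by (simp flip: power_add)
  ultimately obtain u v w where "trisect 0 (F ^ 3) = h + 9 * u" "trisect 1 (F ^ 3) = 3 * v"
    "trisect 2 (F ^ 3) = 3 * w" "trisect 0 (F ^ (3 * k)) = h ^ k + 9 * x"
    "trisect 1 (F ^ (3 * k)) = 3 * y" "trisect 2 (F ^ (3 * k)) = 3 * z"
    "F ^ (3 * Suc k) = F ^ 3 * F ^ (3 * k)" by blast
  note * = this
  have "trisect 0 (F ^ (3 * Suc k)) - h ^ Suc k
      = 9 * (h * x + u * h ^ k + 9 * u * x + X * (v * z + w * y))"
    unfolding * trisect_mult_X by (simp add: algebra_simps)
  moreover have "trisect 1 (F ^ (3 * Suc k)) = 3 * ((h + 9 * u) * y + v * (h ^ k + 9 * x) + 3 * X * w * z)"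
    unfolding * trisect_mult_X by (simp add: algebra_simps)
  moreover have "trisect 2 (F ^ (3 * Suc k)) = 3 * ((h + 9 * u) * z + 3 * v * y + w * (h ^ k + 9 * x))"
    unfolding * trisect_mult_X by (simp add: algebra_simps)
  ultimately show ?case
    by (metis dvd_triv_left)
qed

lemma trisect_0_F12: "\<exists>Z. trisect 0 (F ^ 12) = F ^ 16 * B ^ 4 + 9 * Z"
proof -
  obtain Z where "trisect 0 (F ^ 12) - h ^ 4 = 9 * Z"
    using trisect_F3k [of 4] by auto
  then have "trisect 0 (F ^ 12) = F ^ 16 * B ^ 4 + 9 * Z"
    by (simp add: h_def algebra_simps power_mult_distrib flip: power_mult)
  then show ?thesis ..
qed

lemma trisect_1_F12: "3 dvd trisect 1 (F ^ 12)"
  using trisect_F3k [of 4] by simp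

text \<open>Modulo 3 only class 0 of \<open>F ^ 15\<close>, namely \<open>h ^ 5\<close>, meets class
  2 of \<open>F\<close>.\<close>

lemma trisect_2_F16: "\<exists>Z. trisect 2 (F ^ 16) = F ^ 24 * B ^ 8 + 3 * Z"
proof -
  obtain x y z where xyz: "trisect 0 (F ^ 15) - h ^ 5 = 9 * x"
    "trisect 1 (F ^ 15) = 3 * y" "trisect 2 (F ^ 15) = 3 * z"
    using trisect_F3k [of 5] by (auto elim!: dvdE)
  then have x: "trisect 0 (F ^ 15) = h ^ 5 + 9 * x"
    by (simp add: algebra_simps)
  have F16: "F ^ 16 = F ^ 15 * F" by (simp add: power_numeral_reduce)
  have "trisect 2 (F ^ 16) = F ^ 24 * B ^ 8
      + 3 * (3 * x * F ^ 4 * B ^ 3 - y * F ^ 4 * B ^ 2 * A + z * F ^ 4 * B * A ^ 2)"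
    unfolding F16 trisect_mult_X x xyz(2,3) trisect_F h_def by algebra
  then show ?thesis ..
qed

text \<open>Each product contributing to class 2 contains class 1 or 2 of \<open>F ^ 6\<close>, or
  class 2 of \<open>F ^ 2\<close>; all three are multiples of 3.\<close>

lemma trisect_2_F8: "3 dvd trisect 2 (F ^ 8)"
proof -
  have F8: "F ^ 8 = F ^ 6 * F ^ 2" by (simp flip: power_add)
  show ?thesis
    using trisect_F3k [of 2] unfolding F8 trisect_mult_X trisect_F2 by simp
qed

lemma trisect_1_B_mult: "trisect 1 (B ^ k * f) = P ^ k * trisect 1 f"
  and trisect_2_B_mult: "trisect 2 (B ^ k * f) = P ^ k * trisect 2 f"
  by (simp_all add: B_def P_def trisect_cubed_mult flip: cubed_power)

text \<open>The coefficients 10, 36, 27 of \<open>trisect_2_F4\<close> determine the precision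
  needed modulo 81: \<open>F ^ 8\<close> modulo 81, \<open>F ^ 12\<close> modulo 9 and
  \<open>F ^ 16\<close> modulo 3.\<close>

lemma trisect_difference:
  "\<exists>Z. trisect 1 (trisect 2 (F ^ 4)) - trisect 2 (F ^ 4) =
     9 * (4 * (B ^ 4 * F ^ 8) + 5 * (B ^ 8 * (X * F ^ 12))) + 81 * Z"
proof -
  obtain x where x: "trisect 1 (F ^ 8) = - 8 * (F ^ 12 * B ^ 4) + 306 * (X * F ^ 16 * B ^ 8)
     - 2160 * (X ^ 2 * F ^ 20 * B ^ 12) + 81 * x"
    using trisect_1_F8 by blast
  obtain y where y: "trisect 0 (F ^ 12) = F ^ 16 * B ^ 4 + 9 * y"
    using trisect_0_F12 by blast
  obtain z where z: "trisect 2 (F ^ 16) = F ^ 24 * B ^ 8 + 3 * z"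
    using trisect_2_F16 by blast
  have "trisect 2 (F ^ 4) = 10 * (B ^ 4 * F ^ 8) - 36 * (B ^ 8 * (X * F ^ 12))
      + 27 * (B ^ 12 * (X ^ 2 * F ^ 16))"
    unfolding trisect_2_F4 by (simp add: mult_ac)
  then have "trisect 1 (trisect 2 (F ^ 4)) = 10 * (P ^ 4 * trisect 1 (F ^ 8))
      - 36 * (P ^ 8 * trisect 0 (F ^ 12)) + 27 * (P ^ 12 * (X * trisect 2 (F ^ 16)))"
    by (simp only: trisect_add trisect_diff trisect_numeral_mult trisect_1_B_mult)
       (simp add: trisect_X_mult [folded X_def] trisect_X2_mult [folded X_def])
  also have "\<dots> = - 80 * (F ^ (8 + 4) * P ^ 4 * B ^ 4) + 3060 * (X * (F ^ (12 + 4) * P ^ 4) * B ^ 8)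
      - 21600 * (X ^ 2 * (F ^ (16 + 4) * P ^ 4) * B ^ 12)
      - 36 * (F ^ (8 + 8) * P ^ 8 * B ^ 4) + 27 * (X * (F ^ (12 + 12) * P ^ 12) * B ^ 8)
      + 81 * (10 * P ^ 4 * x - 4 * P ^ 8 * y + P ^ 12 * X * z)"
    unfolding x y z by (simp add: algebra_simps)
  also have "\<dots> = - 116 * (F ^ 8 * B ^ 4) + 3087 * (X * F ^ 12 * B ^ 8)
      - 21600 * (X ^ 2 * F ^ 16 * B ^ 12)
      + 81 * (10 * P ^ 4 * x - 4 * P ^ 8 * y + P ^ 12 * X * z)"
    unfolding F_power_psi_power by algebra
  finally have G: "trisect 1 (trisect 2 (F ^ 4)) = - 116 * (F ^ 8 * B ^ 4) + 3087 * (X * F ^ 12 * B ^ 8)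
      - 21600 * (X ^ 2 * F ^ 16 * B ^ 12)
      + 81 * (10 * P ^ 4 * x - 4 * P ^ 8 * y + P ^ 12 * X * z)" .
  have "trisect 1 (trisect 2 (F ^ 4)) - trisect 2 (F ^ 4) =
     9 * (4 * (B ^ 4 * F ^ 8) + 5 * (B ^ 8 * (X * F ^ 12)))
      + 81 * (10 * P ^ 4 * x - 4 * P ^ 8 * y + P ^ 12 * X * z
        - 2 * (B ^ 4 * F ^ 8) + 38 * (X * F ^ 12 * B ^ 8) - 267 * (X ^ 2 * F ^ 16 * B ^ 12))"
    unfolding G unfolding trisect_2_F4 by algebra
  then show ?thesis ..
qed

lemma trisect_difference_dvd:
  defines "D \<equiv> trisect 1 (trisect 2 (F ^ 4)) - trisect 2 (F ^ 4)"
  shows "9 dvd D" and "81 dvd trisect 1 D" and "27 dvd trisect 2 D"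
proof -
  obtain Z where D: "D = 9 * (4 * (B ^ 4 * F ^ 8) + 5 * (B ^ 8 * (X * F ^ 12))) + 81 * Z"
    using trisect_difference unfolding D_def by blast
  have "D = 9 * (4 * (B ^ 4 * F ^ 8) + 5 * (B ^ 8 * (X * F ^ 12)) + 9 * Z)"
    unfolding D by simp
  then show "9 dvd D" by (rule dvdI)
  obtain x where x: "trisect 1 (F ^ 8) = - 8 * (F ^ 12 * B ^ 4) + 306 * (X * F ^ 16 * B ^ 8)
     - 2160 * (X ^ 2 * F ^ 20 * B ^ 12) + 81 * x"
    using trisect_1_F8 by blast
  obtain y where y: "trisect 0 (F ^ 12) = F ^ 16 * B ^ 4 + 9 * y"
    using trisect_0_F12 by blast
  have "trisect 1 D = 9 * (4 * (P ^ 4 * trisect 1 (F ^ 8)) + 5 * (P ^ 8 * trisect 0 (F ^ 12)))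
      + 81 * trisect 1 Z"
    unfolding D trisect_add trisect_diff trisect_numeral_mult trisect_1_B_mult
    by (simp add: trisect_X_mult [folded X_def])
  also have "\<dots> = 9 * (- 32 * (F ^ (8 + 4) * P ^ 4 * B ^ 4) + 5 * (F ^ (8 + 8) * P ^ 8 * B ^ 4))
      + 81 * (trisect 1 Z + 4 * P ^ 4 * (34 * (X * F ^ 16 * B ^ 8)
         - 240 * (X ^ 2 * F ^ 20 * B ^ 12) + 9 * x) + 5 * P ^ 8 * y)"
    unfolding x y by (simp add: algebra_simps)
  \<comment> \<open>The two leading terms merge with coefficient -32 + 5 = -27, which together with
    the factor 9 gives -3 * 81.\<close>
  also have "\<dots> = 81 * (trisect 1 Z + 4 * P ^ 4 * (34 * (X * F ^ 16 * B ^ 8)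
         - 240 * (X ^ 2 * F ^ 20 * B ^ 12) + 9 * x) + 5 * P ^ 8 * y - 3 * (F ^ 8 * B ^ 4))"
    unfolding F_power_psi_power by (simp add: algebra_simps)
  finally show "81 dvd trisect 1 D" by (rule dvdI)
  obtain u v where uv: "trisect 2 (F ^ 8) = 3 * u" "trisect 1 (F ^ 12) = 3 * v"
    using trisect_2_F8 trisect_1_F12 by (auto elim!: dvdE)
  have "trisect 2 D = 9 * (4 * (P ^ 4 * trisect 2 (F ^ 8)) + 5 * (P ^ 8 * trisect 1 (F ^ 12)))
      + 81 * trisect 2 Z"
    unfolding D trisect_add trisect_diff trisect_numeral_mult trisect_2_B_mult
    by (simp add: trisect_X_mult [folded X_def])
  \<comment> \<open>The factor \<open>X\<close> shifts class 2 to class 1 of \<open>F ^ 12\<close>,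
    so both terms gain a factor 3.\<close>
  also have "\<dots> = 27 * (4 * P ^ 4 * u + 5 * P ^ 8 * v + 3 * trisect 2 Z)"
    unfolding uv by (simp add: algebra_simps)
  finally show "27 dvd trisect 2 D" by (rule dvdI)
qed

end

section \<open>From power series back to the congruences\<close>

lemma numeral_dvd_fps_nth: "numeral k dvd f \<Longrightarrow> numeral k dvd f $ n" for f :: "int fps"
  by (auto simp: numeral_fps_const elim!: dvdE)

lemma pod_gf_4_nth: "(pod_gf ^ 4) $ n = (-1) ^ n * int (pod_neg 4 n)"
  using pod_tuples_gf_eq [of 4] by (simp add: pod_tuples_gf_def fps_eq_iff)

text \<open>The indices 27n+9r+5 and 9n+3r+2 have opposite parity, so the difference of signed
  coefficients is, up to sign, the sum of the two counts; hence the minus sign in the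
  congruence.\<close>

lemma pod_neg_4_cong_iff:
  "[int (pod_neg 4 (27 * n + (9 * r + 5))) = - int (pod_neg 4 (9 * n + (3 * r + 2)))] (mod m) \<longleftrightarrow>
   m dvd (trisect 1 (trisect 2 (pod_gf ^ 4)) - trisect 2 (pod_gf ^ 4)) $ (3 * n + r)"
proof -
  have "(trisect 1 (trisect 2 (pod_gf ^ 4)) - trisect 2 (pod_gf ^ 4)) $ (3 * n + r) =
      (pod_gf ^ 4) $ (27 * n + (9 * r + 5)) - (pod_gf ^ 4) $ (9 * n + (3 * r + 2))"
    by (simp add: algebra_simps)
  also have "\<dots> = - ((-1) ^ (n + r) * (int (pod_neg 4 (27 * n + (9 * r + 5))) - (- int (pod_neg 4 (9 * n + (3 * r + 2))))))"
    unfolding pod_gf_4_nth by (simp add: minus_one_power_iff algebra_simps)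
  finally show ?thesis
    unfolding cong_iff_dvd_diff
    by (simp only: minus_one_power_iff mult_1_left mult_minus1 dvd_minus_iff split: if_split) simp
qed

theorem theorem3p1:
  fixes n :: nat
  shows "[int (pod_neg 4 (27 * n + 5)) = - int (pod_neg 4 (9 * n + 2))] (mod 9) \<and>
         [int (pod_neg 4 (27 * n + 14)) = - int (pod_neg 4 (9 * n + 5))] (mod 81) \<and>
         [int (pod_neg 4 (27 * n + 23)) = - int (pod_neg 4 (9 * n + 8))] (mod 27)"
proof -
  let ?D = "trisect 1 (trisect 2 (pod_gf ^ 4)) - trisect 2 (pod_gf ^ 4)"
  \<comment> \<open>Divisibility by 9 holds for the whole series and is read off in class 0; classes
    1 and 2 have the stronger moduli.\<close>
  have "9 dvd ?D $ (3 * n + 0)" "81 dvd trisect 1 ?D $ n" "27 dvd trisect 2 ?D $ n"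
    by (intro numeral_dvd_fps_nth trisect_difference_dvd)+
  then show ?thesis
    using pod_neg_4_cong_iff [of n 0 9] pod_neg_4_cong_iff [of n 1 81] pod_neg_4_cong_iff [of n 2 27]
    by (simp only: trisect_nth) simp
qed

end
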